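(* Let $E$ be a Banach space, $0\le r<\infty$, $I^r=[-r,0]$, and let $H\subset\mathrm{Map}(I^r,E)$ be a history space. Assume that $\boldsymbol 0$ is closed under $C^1$-prolongations with $0$-derivative in $H$ (so that $C^1(I^r,E)\subset H$). Then the following properties are equivalent: (a) $H$ is regulated by $C^1$-prolongations. (b) The topology of $H$ (restricted to $C^1(I^r,E)$) is coarser than or equal to the topology of uniform $C^1$-convergence on $C^1(I^r,E)$; that is, the inclusion map $\bigl(C^1(I^r,E),\|\cdot\|_{C^1}\bigr)\to H$ is continuous.
   Context: $\mathbb{R}_+=[0,\infty)$. $\mathrm{Map}(I,E)$ is the linear space of all maps $I\to E$; $\boldsymbol 0$ is the zero map. A history space is a linear subspace $H\subset\mathrm{Map}(I,E)$ with a topology for which the linear operations are continuous. For an interval $J$, $J+I=\{t+\theta:t\in J,\theta\in I\}$; for $\gamma\colon J+I\to E$ and $t\in J$, $I_t\gamma\in\mathrm{Map}(I,E)$ is $I_t\gamma(\theta)=\gamma(t+\theta)$. Here $I=I^r$. $\|f\|_{C^1}=\sup\|f\|_E+\sup\|f'\|_E$ (suprema over the interval of definition; on the degenerate interval $I^0=\{0\}$ every map counts as $C^1$ with derivative $0$), and $\|f\|_{C^1[0,T]}$ is this norm of $f|_{[0,T]}$. A $C^1$-prolongation of $\boldsymbol 0$ is a map $\gamma\colon J+I\to E$, where $J$ is an interval with left end point $0\in J$ ($J=\{0\}$ allowed, counting as $C^1$), with $\gamma(\theta)=0$ for $\theta\in I$ and $\gamma|_J$ of class $C^1$ (one-sided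 derivatives at end points); it is "with $0$-derivative" if the right derivative $\gamma'(0)$ is $0$. "$\boldsymbol 0$ is closed under $C^1$-prolongations with $0$-derivative in $H$" means that $I_t\gamma\in H$ for all $t\ge0$ and every $C^1$-prolongation $\gamma\colon\mathbb{R}_++I\to E$ of $\boldsymbol 0$ with $0$-derivative. For $T>0$ and $0\le\delta\le\infty$, $\varGamma^1_{0,\boldsymbol 0}(T,\delta,0)$ is the set of $C^1$-prolongations $\gamma\colon[0,T]+I\to E$ of $\boldsymbol 0$ with $0$-derivative and $\|\gamma\|_{C^1[0,T]}\le\delta$; $\varGamma^1_{0,\boldsymbol 0}(0,\delta,0)=\{\boldsymbol 0\}$. Put $$\varLambda^1_{0,\boldsymbol 0}(T,\delta,0)=\bigcup_{\tau\in[0,T]}\{(\tau,I_\tau\gamma):\gamma\in\varGamma^1_{0,\boldsymbol 0}(\tau,\delta,0)\}.$$ $H$ is regulated by $C^1$-prolongations if for every $T>0$ and every neighborhood $N$ of $\boldsymbol 0$ in $H$ there is $\delta>0$ with $\varLambda^1_{0,\boldsymbol 0}(T,\delta,0)\subset[0,T]\times N$. *)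

theory Defs
  imports "HOL-Analysis.Analysis"
begin

text \<open>
  \<open>Map(D, E)\<close> is represented by \<^term>\<open>D \<rightarrow>\<^sub>E UNIV\<close>: functions on the reals that take the
  fixed junk value \<^const>\<open>undefined\<close> off \<open>D\<close>, so that equality is equality on \<open>D\<close>.  Since the
  pointwise operations do not preserve the junk value, the linear operations and the
  zero map are restricted to \<open>D\<close>.
\<close>

definition zero_map :: "real set \<Rightarrow> real \<Rightarrow> 'e::real_normed_vector" where
  "zero_map D = (\<lambda>\<theta>\<in>D. 0)"

definition add_map ::
  "real set \<Rightarrow> (real \<Rightarrow> 'e) \<Rightarrow> (real \<Rightarrow> 'e) \<Rightarrow> real \<Rightarrow> 'e::real_normed_vector" where
  "add_map D f g = (\<lambda>\<theta>\<in>D. f \<theta> + g \<theta>)"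

definition scale_map ::
  "real set \<Rightarrow> real \<Rightarrow> (real \<Rightarrow> 'e) \<Rightarrow> real \<Rightarrow> 'e::real_normed_vector" where
  "scale_map D c f = (\<lambda>\<theta>\<in>D. c *\<^sub>R f \<theta>)"

abbreviation hist_interval :: "real \<Rightarrow> real set" where
  "hist_interval r \<equiv> {- r..0}"

text \<open>
  The underlying linear subspace of a history space is the \<^const>\<open>topspace\<close> of its topology.
  No separation axiom is imposed.
\<close>

definition history_space ::
  "real set \<Rightarrow> (real \<Rightarrow> 'e::real_normed_vector) topology \<Rightarrow> bool" where
  "history_space I H \<longleftrightarrow>
     topspace H \<subseteq> I \<rightarrow>\<^sub>E UNIV \<and>
     zero_map I \<in> topspace H \<and>
     (\<forall>f\<in>topspace H. \<forall>g\<in>topspace H. add_map I f g \<in> topspace H) \<and>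
     (\<forall>c. \<forall>f\<in>topspace H. scale_map I c f \<in> topspace H) \<and>
     continuous_map (prod_topology H H) H (\<lambda>(f, g). add_map I f g) \<and>
     continuous_map (prod_topology euclideanreal H) H (\<lambda>(c, f). scale_map I c f)"

definition interval_sum :: "real set \<Rightarrow> real set \<Rightarrow> real set" where
  "interval_sum J I = {t + \<theta> |t \<theta>. t \<in> J \<and> \<theta> \<in> I}"

definition segment_at :: "real set \<Rightarrow> real \<Rightarrow> (real \<Rightarrow> 'e) \<Rightarrow> real \<Rightarrow> 'e" where
  "segment_at I t \<gamma> = (\<lambda>\<theta>\<in>I. \<gamma> (t + \<theta>))"

text \<open>
  Derivatives are taken within the interval \<open>J\<close>, hence one-sided at its end points.
  (The library's \<open>C1_differentiable_on\<close> is not suitable: it uses two-sided derivatives.)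
  On a one-point interval \<open>at t within J\<close> is trivial, so every map is \<open>C\<^sup>1\<close> there, but
  \<^const>\<open>vector_derivative\<close> is then an arbitrary value and is replaced by \<open>0\<close>.
\<close>

definition C1_on :: "real set \<Rightarrow> (real \<Rightarrow> 'e::real_normed_vector) \<Rightarrow> bool" where
  "C1_on J f \<longleftrightarrow>
     (\<exists>f'. (\<forall>t\<in>J. (f has_vector_derivative f' t) (at t within J)) \<and> continuous_on J f')"

definition deriv_on :: "real set \<Rightarrow> (real \<Rightarrow> 'e) \<Rightarrow> real \<Rightarrow> 'e::real_normed_vector" where
  "deriv_on J f t = (if J = {t} then 0 else vector_derivative f (at t within J))"

text \<open>
  Used only for \<open>f\<close> of class \<open>C\<^sup>1\<close> on a nonempty compact interval \<open>J\<close>, where both suprema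
  are finite.
\<close>

definition C1_norm :: "real set \<Rightarrow> (real \<Rightarrow> 'e::real_normed_vector) \<Rightarrow> real" where
  "C1_norm J f = (SUP t\<in>J. norm (f t)) + (SUP t\<in>J. norm (deriv_on J f t))"

definition C1_maps :: "real set \<Rightarrow> (real \<Rightarrow> 'e::real_normed_vector) set" where
  "C1_maps I = {f \<in> I \<rightarrow>\<^sub>E UNIV. C1_on I f}"

text \<open>
  The value \<open>0\<close> off \<^const>\<open>C1_maps\<close> is irrelevant for the topology; it is there because the
  locale \<^locale>\<open>Metric_space\<close> asks for nonnegativity and symmetry on the whole type.
\<close>

definition C1_dist ::
  "real set \<Rightarrow> (real \<Rightarrow> 'e) \<Rightarrow> (real \<Rightarrow> 'e::real_normed_vector) \<Rightarrow> real" where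
  "C1_dist I f g =
     (if f \<in> C1_maps I \<and> g \<in> C1_maps I then C1_norm I (\<lambda>\<theta>\<in>I. f \<theta> - g \<theta>) else 0)"

definition C1_topology :: "real set \<Rightarrow> (real \<Rightarrow> 'e::real_normed_vector) topology" where
  "C1_topology I = Metric_space.mtopology (C1_maps I) (C1_dist I)"

definition C1_prolongation_of_zero ::
  "real set \<Rightarrow> real set \<Rightarrow> (real \<Rightarrow> 'e::real_normed_vector) \<Rightarrow> bool" where
  "C1_prolongation_of_zero I J \<gamma> \<longleftrightarrow>
     is_interval J \<and> 0 \<in> J \<and> J \<subseteq> {0..} \<and>
     \<gamma> \<in> interval_sum J I \<rightarrow>\<^sub>E UNIV \<and>
     (\<forall>\<theta>\<in>I. \<gamma> \<theta> = 0) \<and>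
     C1_on J \<gamma>"

definition C1_prolongation_of_zero_0deriv ::
  "real set \<Rightarrow> real set \<Rightarrow> (real \<Rightarrow> 'e::real_normed_vector) \<Rightarrow> bool" where
  "C1_prolongation_of_zero_0deriv I J \<gamma> \<longleftrightarrow>
     C1_prolongation_of_zero I J \<gamma> \<and> deriv_on J \<gamma> 0 = 0"

definition zero_closed_under_C1_prolongations ::
  "real set \<Rightarrow> (real \<Rightarrow> 'e::real_normed_vector) topology \<Rightarrow> bool" where
  "zero_closed_under_C1_prolongations I H \<longleftrightarrow>
     (\<forall>\<gamma>. C1_prolongation_of_zero_0deriv I {0..} \<gamma> \<longrightarrow>
       (\<forall>t\<ge>0. segment_at I t \<gamma> \<in> topspace H))"

text \<open>
  In the next two definitions \<open>\<delta>\<close> ranges over \<open>[0, \<infinity>]\<close>, which is the type \<^typ>\<open>ennreal\<close>.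
\<close>

definition Gamma1 ::
  "real set \<Rightarrow> real \<Rightarrow> ennreal \<Rightarrow> (real \<Rightarrow> 'e::real_normed_vector) set" where
  "Gamma1 I T \<delta> =
     (if T = 0 then {zero_map I}
      else {\<gamma>. C1_prolongation_of_zero_0deriv I {0..T} \<gamma> \<and> ennreal (C1_norm {0..T} \<gamma>) \<le> \<delta>})"

definition Lambda1 ::
  "real set \<Rightarrow> real \<Rightarrow> ennreal \<Rightarrow> (real \<times> (real \<Rightarrow> 'e::real_normed_vector)) set" where
  "Lambda1 I T \<delta> = (\<Union>\<tau>\<in>{0..T}. {(\<tau>, segment_at I \<tau> \<gamma>) |\<gamma>. \<gamma> \<in> Gamma1 I \<tau> \<delta>})"

definition regulated_by_C1_prolongations ::
  "real set \<Rightarrow> (real \<Rightarrow> 'e::real_normed_vector) topology \<Rightarrow> bool" where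
  "regulated_by_C1_prolongations I H \<longleftrightarrow>
     (\<forall>T>0. \<forall>N\<subseteq>topspace H. (\<exists>U. openin H U \<and> zero_map I \<in> U \<and> U \<subseteq> N) \<longrightarrow>
       (\<exists>\<delta>>0. Lambda1 I T \<delta> \<subseteq> {0..T} \<times> N))"

text \<open>
  Sanity check: the metric that defines \<^const>\<open>C1_topology\<close> is one in the sense of the library,
  so that the locale facts about \<open>mtopology\<close> apply.
\<close>

lemma deriv_on_eq:
  fixes a b :: real
  assumes "a < b" "t \<in> {a..b}" "(f has_vector_derivative D) (at t within {a..b})"
  shows "deriv_on {a..b} f t = D"
  using assms vector_derivative_within_cbox[of a b t f D] by (auto simp: deriv_on_def)

lemma C1_bdd:
  fixes a b :: real
  assumes "a \<le> b" "C1_on {a..b} f"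
  shows "bdd_above ((\<lambda>t. norm (f t)) ` {a..b})"
    and "bdd_above ((\<lambda>t. norm (deriv_on {a..b} f t)) ` {a..b})"
proof -
  obtain f' where f': "\<And>t. t\<in>{a..b} \<Longrightarrow> (f has_vector_derivative f' t) (at t within {a..b})"
    "continuous_on {a..b} f'" using assms(2) unfolding C1_on_def by blast
  have "continuous_on {a..b} f"
    using f'(1) by (meson continuous_on_eq_continuous_within has_vector_derivative_continuous)
  then show "bdd_above ((\<lambda>t. norm (f t)) ` {a..b})"
    by (intro bounded_imp_bdd_above compact_imp_bounded compact_continuous_image continuous_intros) auto
  show "bdd_above ((\<lambda>t. norm (deriv_on {a..b} f t)) ` {a..b})"
  proof (cases "a < b")
    case True
    have "(\<lambda>t. norm (deriv_on {a..b} f t)) ` {a..b} = (\<lambda>t. norm (f' t)) ` {a..b}"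
      using deriv_on_eq[OF True _ f'(1)] by (intro image_cong) auto
    moreover have "bdd_above ((\<lambda>t. norm (f' t)) ` {a..b})"
      using f'(2) by (intro bounded_imp_bdd_above compact_imp_bounded compact_continuous_image continuous_intros) auto
    ultimately show ?thesis by simp
  next
    case False
    then show ?thesis using assms by simp
  qed
qed

lemma C1_diff:
  fixes a b :: real
  assumes "a \<le> b" "C1_on {a..b} f" "C1_on {a..b} g"
  shows "C1_on {a..b} (\<lambda>\<theta>\<in>{a..b}. f \<theta> - g \<theta>)"
    and "t \<in> {a..b} \<Longrightarrow> deriv_on {a..b} (\<lambda>\<theta>\<in>{a..b}. f \<theta> - g \<theta>) t
      = deriv_on {a..b} f t - deriv_on {a..b} g t"
proof -
  obtain f' where f': "\<And>t. t\<in>{a..b} \<Longrightarrow> (f has_vector_derivative f' t) (at t within {a..b})"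
    "continuous_on {a..b} f'" using assms(2) unfolding C1_on_def by blast
  obtain g' where g': "\<And>t. t\<in>{a..b} \<Longrightarrow> (g has_vector_derivative g' t) (at t within {a..b})"
    "continuous_on {a..b} g'" using assms(3) unfolding C1_on_def by blast
  have d: "((\<lambda>\<theta>\<in>{a..b}. f \<theta> - g \<theta>) has_vector_derivative (f' t - g' t)) (at t within {a..b})"
    if "t \<in> {a..b}" for t
    by (rule has_vector_derivative_transform[OF that _ has_vector_derivative_diff[OF f'(1) g'(1)]])
       (use that in auto)
  then show "C1_on {a..b} (\<lambda>\<theta>\<in>{a..b}. f \<theta> - g \<theta>)"
    unfolding C1_on_def using f'(2) g'(2)
    by (intro exI[of _ "\<lambda>t. f' t - g' t"]) (auto intro!: continuous_intros)
  show "deriv_on {a..b} (\<lambda>\<theta>\<in>{a..b}. f \<theta> - g \<theta>) t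
      = deriv_on {a..b} f t - deriv_on {a..b} g t" if t: "t \<in> {a..b}"
  proof (cases "a < b")
    case True
    show ?thesis using deriv_on_eq[OF True t d[OF t]] deriv_on_eq[OF True t f'(1)[OF t]]
      deriv_on_eq[OF True t g'(1)[OF t]] by simp
  next
    case False
    then have "{a..b} = {t}" using t by auto
    then show ?thesis by (simp add: deriv_on_def)
  qed
qed

lemma C1_dist_eq:
  fixes a b :: real and f g :: "real \<Rightarrow> 'e::real_normed_vector"
  assumes "a \<le> b" "f \<in> C1_maps {a..b}" "g \<in> C1_maps {a..b}"
  shows "C1_dist {a..b} f g = (SUP t\<in>{a..b}. norm (f t - g t))
     + (SUP t\<in>{a..b}. norm (deriv_on {a..b} f t - deriv_on {a..b} g t))"
    and "bdd_above ((\<lambda>t. norm (f t - g t)) ` {a..b})"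
    and "bdd_above ((\<lambda>t. norm (deriv_on {a..b} f t - deriv_on {a..b} g t)) ` {a..b})"
proof -
  let ?A = "\<lambda>t. norm (f t - g t)"
  let ?B = "\<lambda>t. norm (deriv_on {a..b} f t - deriv_on {a..b} g t)"
  have C: "C1_on {a..b} f" "C1_on {a..b} g" using assms by (auto simp: C1_maps_def)
  have 1: "(\<lambda>t. norm ((\<lambda>\<theta>\<in>{a..b}. f \<theta> - g \<theta>) t)) ` {a..b} = ?A ` {a..b}" by auto
  have 2: "(\<lambda>t. norm (deriv_on {a..b} (\<lambda>\<theta>\<in>{a..b}. f \<theta> - g \<theta>) t)) ` {a..b} = ?B ` {a..b}"
    using C1_diff(2)[OF assms(1) C] by (intro image_cong) auto
  show "C1_dist {a..b} f g = (SUP t\<in>{a..b}. ?A t) + (SUP t\<in>{a..b}. ?B t)"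
    using assms unfolding C1_dist_def C1_norm_def 1 2 by simp
  show "bdd_above (?A ` {a..b})" "bdd_above (?B ` {a..b})"
    using C1_bdd[OF assms(1) C1_diff(1)[OF assms(1) C]] unfolding 1 2 by auto
qed

lemma Metric_space_C1_dist:
  fixes a b :: real
  assumes ab: "a \<le> b"
  shows "Metric_space (C1_maps {a..b}) (C1_dist {a..b} :: (real \<Rightarrow> 'e::real_normed_vector) \<Rightarrow> _)"
proof -
  let ?J = "{a..b}" and ?M = "C1_maps {a..b} :: (real \<Rightarrow> 'e) set"
  have sup_nonneg: "0 \<le> (SUP t\<in>?J. norm (h t))"
    if "bdd_above ((\<lambda>t. norm (h t)) ` ?J)" for h :: "real \<Rightarrow> 'e"
    using ab that by (intro cSUP_upper2[of _ _ a]) auto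
  have tri: "(SUP t\<in>?J. norm (u t - w t)) \<le> (SUP t\<in>?J. norm (u t - v t)) + (SUP t\<in>?J. norm (v t - w t))"
    if "bdd_above ((\<lambda>t. norm (u t - v t)) ` ?J)" "bdd_above ((\<lambda>t. norm (v t - w t)) ` ?J)"
    for u v w :: "real \<Rightarrow> 'e"
  proof (rule cSUP_least)
    show "?J \<noteq> {}" using ab by simp
    fix t assume t: "t \<in> ?J"
    have "norm (u t - w t) \<le> norm (u t - v t) + norm (v t - w t)"
      using norm_triangle_ineq[of "u t - v t" "v t - w t"] by simp
    also have "\<dots> \<le> (SUP t\<in>?J. norm (u t - v t)) + (SUP t\<in>?J. norm (v t - w t))"
      by (intro add_mono cSUP_upper[OF t] that)
    finally show "norm (u t - w t) \<le> (SUP t\<in>?J. norm (u t - v t)) + (SUP t\<in>?J. norm (v t - w t))" .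
  qed
  have nonneg: "0 \<le> C1_dist ?J f g" for f g :: "real \<Rightarrow> 'e"
  proof (cases "f \<in> ?M \<and> g \<in> ?M")
    case True
    then have M: "f \<in> ?M" "g \<in> ?M" by auto
    show ?thesis unfolding C1_dist_eq(1)[OF ab M]
      by (intro add_nonneg_nonneg sup_nonneg C1_dist_eq(2,3)[OF ab M])
  qed (auto simp: C1_dist_def)
  show ?thesis
  proof
    show "0 \<le> C1_dist ?J f g" for f g :: "real \<Rightarrow> 'e" by (rule nonneg)
    show "C1_dist ?J f g = C1_dist ?J g f" for f g :: "real \<Rightarrow> 'e"
      by (cases "f \<in> ?M \<and> g \<in> ?M")
        (simp_all add: C1_dist_eq[OF ab] norm_minus_commute, auto simp: C1_dist_def)
    fix f g h :: "real \<Rightarrow> 'e"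
    assume f: "f \<in> ?M" and g: "g \<in> ?M"
    show "C1_dist ?J f g = 0 \<longleftrightarrow> f = g"
    proof
      assume "f = g"
      then show "C1_dist ?J f g = 0" using ab C1_dist_eq(1)[OF ab f g] by simp
    next
      assume 0: "C1_dist ?J f g = 0"
      have s: "(SUP t\<in>?J. norm (f t - g t)) = 0"
        using 0 sup_nonneg[OF C1_dist_eq(2)[OF ab f g]] sup_nonneg[OF C1_dist_eq(3)[OF ab f g]]
        by (simp add: C1_dist_eq(1)[OF ab f g])
      have "f t = g t" if "t \<in> ?J" for t
        using cSUP_upper[OF that C1_dist_eq(2)[OF ab f g]] s by simp
      moreover have "f \<in> ?J \<rightarrow>\<^sub>E UNIV" "g \<in> ?J \<rightarrow>\<^sub>E UNIV" using f g by (simp_all add: C1_maps_def)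
      ultimately show "f = g" by (meson PiE_ext)
    qed
    assume h: "h \<in> ?M"
    show "C1_dist ?J f h \<le> C1_dist ?J f g + C1_dist ?J g h"
      using tri[OF C1_dist_eq(2)[OF ab f g] C1_dist_eq(2)[OF ab g h]]
        tri[OF C1_dist_eq(3)[OF ab f g] C1_dist_eq(3)[OF ab g h]]
      by (simp add: C1_dist_eq(1)[OF ab f g] C1_dist_eq(1)[OF ab g h] C1_dist_eq(1)[OF ab f h])
  qed
qed

end

theory Submission
  imports Defs
begin

text \<open>
  Both properties compare neighbourhoods of \<open>0\<close> in \<open>H\<close> with small \<open>C\<^sup>1\<close> data, and
  they are linked by passing between a history \<open>\<phi>\<close> and a prolongation that ends in it.

  From histories to prolongations: every \<open>\<phi>\<close> of class \<open>C\<^sup>1\<close> on \<open>[-r,0]\<close> is the segment at time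
  \<open>1 + r\<close> of a prolongation of \<open>0\<close> with \<open>0\<close>-derivative.  On \<open>[0,1]\<close> one takes the cubic Hermite
  interpolant that leaves \<open>0\<close> with derivative \<open>0\<close> and arrives at \<open>\<phi>(-r)\<close> with derivative
  \<open>\<phi>'(-r)\<close>; then one runs through \<open>\<phi>\<close>, and continues affinely for ever
  (\<open>bridge_has_C1_derivative\<close>).  Closedness of \<open>0\<close> under such prolongations therefore puts all of
  \<open>C\<^sup>1\<close> into \<open>H\<close>.  The interpolant depends linearly on \<open>\<phi>(-r)\<close> and \<open>\<phi>'(-r)\<close>, so the
  prolongation has \<open>C\<^sup>1\<close>-norm at most five times that of \<open>\<phi>\<close> on \<open>[0,1+r]\<close>
  (\<open>C1_norm_bridge_le\<close>).  Regulatedness at the single time \<open>T = 1 + r\<close> thus says that a small ball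
  of \<open>C\<^sup>1\<close> lies in a given neighbourhood of \<open>0\<close>; since addition in \<open>H\<close> is continuous, continuity of
  the inclusion at \<open>0\<close> spreads to all of \<open>C\<^sup>1\<close> by translation (\<open>continuous_inclusion_if_at_zero\<close>).

  From prolongations to histories: a prolongation of \<open>0\<close> with \<open>0\<close>-derivative is \<open>C\<^sup>1\<close> across the
  time \<open>0\<close> as well, because the derivatives of both pieces vanish there.  Hence all its segments are
  \<open>C\<^sup>1\<close>, with norm at most that of the prolongation on the elapsed time
  (\<open>segment_of_prolongation\<close>).  So a \<open>C\<^sup>1\<close>-ball inside a neighbourhood provides the \<open>\<delta>\<close> of
  regulatedness, uniformly in \<open>T\<close>.
\<close>

section \<open>Maps of class C1 with a named derivative\<close>

text \<open>
  Naming the derivative makes gluing possible: two pieces fit together exactly when one and the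
  same function serves as derivative on both.
\<close>

definition has_C1_derivative ::
  "(real \<Rightarrow> 'e::real_normed_vector) \<Rightarrow> (real \<Rightarrow> 'e) \<Rightarrow> real set \<Rightarrow> bool" where
  "has_C1_derivative f f' S \<longleftrightarrow>
     (\<forall>t\<in>S. (f has_vector_derivative f' t) (at t within S)) \<and> continuous_on S f'"

lemma C1_on_iff_has_C1_derivative: "C1_on S f \<longleftrightarrow> (\<exists>f'. has_C1_derivative f f' S)"
  by (simp add: C1_on_def has_C1_derivative_def)

lemma has_C1_derivative_subset:
  "has_C1_derivative f f' S \<Longrightarrow> T \<subseteq> S \<Longrightarrow> has_C1_derivative f f' T"
  unfolding has_C1_derivative_def
  by (meson continuous_on_subset has_vector_derivative_within_subset subsetD)

lemma has_C1_derivative_cong: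
  assumes "has_C1_derivative f f' S"
    and "\<And>t. t \<in> S \<Longrightarrow> g t = f t" "\<And>t. t \<in> S \<Longrightarrow> g' t = f' t"
  shows "has_C1_derivative g g' S"
  unfolding has_C1_derivative_def
proof (intro conjI ballI)
  show "continuous_on S g'"
    using assms continuous_on_cong[of S S g' f'] by (auto simp: has_C1_derivative_def)
  fix t assume t: "t \<in> S"
  show "(g has_vector_derivative g' t) (at t within S)"
    using assms(1,3) t
    by (intro has_vector_derivative_transform[OF t assms(2)]) (simp_all add: has_C1_derivative_def)
qed

lemma has_vector_derivative_within_Un:
  assumes "(f has_vector_derivative D) (at t within S)" "(f has_vector_derivative D) (at t within T)"
  shows "(f has_vector_derivative D) (at t within S \<union> T)"
  using assms unfolding has_vector_derivative_def has_derivative_within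
  by (auto simp: Lim_within_Un)

lemma has_vector_derivative_within_isolated:
  assumes "\<not> t islimpt A"
  shows "(f has_vector_derivative D) (at t within A)"
proof -
  have "at t within A = bot"
    using assms trivial_limit_within by blast
  then show ?thesis
    by (simp add: has_vector_derivative_def has_derivative_def bounded_linear_scaleR_left)
qed

text \<open>At a point outside a closed piece, that piece imposes no condition on the derivative.\<close>

lemma has_C1_derivative_Un:
  assumes "closed S" "closed T" "has_C1_derivative f f' S" "has_C1_derivative f f' T"
  shows "has_C1_derivative f f' (S \<union> T)"
  unfolding has_C1_derivative_def
proof (intro conjI ballI)
  show "continuous_on (S \<union> T) f'"
    using assms by (auto simp: has_C1_derivative_def intro: continuous_on_closed_Un)
  have triv: "(f has_vector_derivative D) (at t within A)" if "closed A" "t \<notin> A" for t A D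
    using that closed_limpt has_vector_derivative_within_isolated by blast
  fix t assume "t \<in> S \<union> T"
  then show "(f has_vector_derivative f' t) (at t within S \<union> T)"
    using assms triv unfolding has_C1_derivative_def
    by (intro has_vector_derivative_within_Un) blast+
qed

lemma has_C1_derivative_shift:
  fixes c :: real
  assumes "has_C1_derivative f f' S"
  shows "has_C1_derivative (\<lambda>t. f (c + t)) (\<lambda>t. f' (c + t)) {t. c + t \<in> S}"
  unfolding has_C1_derivative_def
proof (intro conjI ballI)
  have image: "(\<lambda>t. c + t) ` {t. c + t \<in> S} \<subseteq> S"
    by blast
  have "continuous_on S f'"
    using assms by (simp add: has_C1_derivative_def)
  then show "continuous_on {t. c + t \<in> S} (\<lambda>t. f' (c + t))"
    by (rule continuous_on_compose2[OF _ _ image]) (intro continuous_intros)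
  fix t assume t: "t \<in> {t. c + t \<in> S}"
  have "((\<lambda>t. c + t) has_vector_derivative 1) (at t within {t. c + t \<in> S})"
    by (auto intro!: derivative_eq_intros)
  moreover have "(f has_vector_derivative f' (c + t)) (at (c + t) within (\<lambda>t. c + t) ` {t. c + t \<in> S})"
    using has_vector_derivative_within_subset[OF _ image] assms t
    unfolding has_C1_derivative_def by blast
  ultimately show "((\<lambda>t. f (c + t)) has_vector_derivative f' (c + t)) (at t within {t. c + t \<in> S})"
    using vector_diff_chain_within by (fastforce simp: o_def)
qed

lemma deriv_on_interval_eq:
  assumes "is_interval J" "t \<in> J" "J \<noteq> {t}" "(f has_vector_derivative D) (at t within J)"
  shows "deriv_on J f t = D"
proof -
  have "t islimpt J"
    using assms connected_imp_perfect[of J t] by (auto simp: is_interval_connected)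
  then have "at t within J \<noteq> bot"
    by (simp add: trivial_limit_within)
  then show ?thesis
    using assms vector_derivative_within by (auto simp: deriv_on_def)
qed

text \<open>
  The degenerate interval is included: there \<^const>\<open>deriv_on\<close> is \<open>0\<close>, which is as good a
  derivative as any other.
\<close>

lemma has_C1_derivative_deriv_on:
  assumes "is_interval J" "C1_on J f"
  shows "has_C1_derivative f (deriv_on J f) J"
proof -
  obtain f' where f': "has_C1_derivative f f' J"
    using assms C1_on_iff_has_C1_derivative by blast
  show ?thesis
  proof (cases "\<exists>t. J = {t}")
    case True
    then obtain t where J: "J = {t}" by blast
    have "(f has_vector_derivative D) (at t within {t})" for D
      by (rule has_vector_derivative_within_isolated) (simp add: islimpt_finite)
    then show ?thesis
      by (simp add: has_C1_derivative_def J)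
  next
    case False
    then have "deriv_on J f t = f' t" if "t \<in> J" for t
      using that f' deriv_on_interval_eq[OF assms(1) that, of f "f' t"]
      by (simp add: has_C1_derivative_def)
    then show ?thesis
      by (intro has_C1_derivative_cong[OF f']) simp_all
  qed
qed

section \<open>The C1 norm and the C1 distance\<close>

lemma C1_norm_le:
  assumes "a \<le> b" "has_C1_derivative f f' {a..b}"
    and "\<And>t. t \<in> {a..b} \<Longrightarrow> norm (f t) \<le> A" "\<And>t. t \<in> {a..b} \<Longrightarrow> norm (f' t) \<le> B"
  shows "C1_norm {a..b} f \<le> A + B"
proof -
  have "norm (deriv_on {a..b} f t) \<le> B" if t: "t \<in> {a..b}" for t
  proof (cases "{a..b} = {t}")
    case True
    have "0 \<le> B" using assms(4)[OF t] norm_ge_zero order_trans by blast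
    then show ?thesis using True by (simp add: deriv_on_def)
  next
    case False
    then show ?thesis
      using deriv_on_interval_eq[OF is_interval_cc t False, of f "f' t"] assms(2,4) t
      by (simp add: has_C1_derivative_def)
  qed
  then show ?thesis
    unfolding C1_norm_def using assms by (intro add_mono cSUP_least) auto
qed

lemma C1_norm_upper:
  fixes f :: "real \<Rightarrow> 'e::real_normed_vector"
  assumes "a \<le> b" "C1_on {a..b} f" "t \<in> {a..b}"
  shows "norm (f t) \<le> C1_norm {a..b} f" "norm (deriv_on {a..b} f t) \<le> C1_norm {a..b} f"
proof -
  have *: "norm (f t) \<le> (SUP t\<in>{a..b}. norm (f t))"
    "norm (deriv_on {a..b} f t) \<le> (SUP t\<in>{a..b}. norm (deriv_on {a..b} f t))"
    using C1_bdd[OF assms(1,2)] assms(3) by (auto intro!: cSUP_upper)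
  then show "norm (f t) \<le> C1_norm {a..b} f" "norm (deriv_on {a..b} f t) \<le> C1_norm {a..b} f"
    using norm_ge_zero[of "f t"] norm_ge_zero[of "deriv_on {a..b} f t"]
    unfolding C1_norm_def by linarith+
qed

lemma zero_map_in_C1_maps: "zero_map I \<in> C1_maps I"
proof -
  have "has_C1_derivative (\<lambda>t. 0) (\<lambda>t. 0) I"
    by (auto simp: has_C1_derivative_def)
  then have "has_C1_derivative (zero_map I) (\<lambda>t. 0) I"
    by (rule has_C1_derivative_cong) (auto simp: zero_map_def)
  then show ?thesis
    by (auto simp: C1_maps_def C1_on_iff_has_C1_derivative zero_map_def)
qed

lemma C1_dist_zero_map:
  assumes "f \<in> C1_maps I"
  shows "C1_dist I f (zero_map I) = C1_norm I f"
proof -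
  have "(\<lambda>\<theta>\<in>I. f \<theta> - zero_map I \<theta>) = f"
    using assms by (auto simp: C1_maps_def zero_map_def PiE_def extensional_def)
  then show ?thesis
    using assms zero_map_in_C1_maps[of I, where ?'a = 'a] by (simp add: C1_dist_def)
qed

section \<open>Prolongations ending in a prescribed history\<close>

lemma interval_sum_supersets:
  shows "0 \<in> I \<Longrightarrow> J \<subseteq> interval_sum J I" and "0 \<in> J \<Longrightarrow> I \<subseteq> interval_sum J I"
  unfolding interval_sum_def by force+

lemma restrict_is_prolongation_of_zero:
  assumes "is_interval J" "0 \<in> J" "J \<noteq> {0}" "J \<subseteq> {0..}" "0 \<in> I"
    and "has_C1_derivative g g' J" "\<And>\<theta>. \<theta> \<in> I \<Longrightarrow> g \<theta> = 0" "g' 0 = 0"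
  shows "C1_prolongation_of_zero_0deriv I J (\<lambda>s\<in>interval_sum J I. g s)"
proof -
  let ?\<gamma> = "\<lambda>s\<in>interval_sum J I. g s"
  have J: "J \<subseteq> interval_sum J I" and I: "I \<subseteq> interval_sum J I"
    using interval_sum_supersets assms(2,5) by blast+
  have \<gamma>: "has_C1_derivative ?\<gamma> g' J"
    using has_C1_derivative_cong[OF assms(6)] J by (simp add: subset_iff)
  then have "deriv_on J ?\<gamma> 0 = 0"
    using deriv_on_interval_eq[OF assms(1,2,3), of ?\<gamma> 0] assms(2,8)
    by (auto simp: has_C1_derivative_def)
  then show ?thesis
    using assms I \<gamma>
    by (auto simp: C1_prolongation_of_zero_0deriv_def C1_prolongation_of_zero_def
        C1_on_iff_has_C1_derivative)
qed

lemma segment_at_restrict: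
  "t \<in> J \<Longrightarrow> segment_at I t (\<lambda>s\<in>interval_sum J I. g s) = (\<lambda>\<theta>\<in>I. g (t + \<theta>))"
  unfolding segment_at_def interval_sum_def by (rule restrict_ext) auto

text \<open>The cubic on \<open>[0,1]\<close> from value and derivative \<open>0\<close> to value \<open>a\<close> and derivative \<open>b\<close>.\<close>

definition hermite :: "'e::real_normed_vector \<Rightarrow> 'e \<Rightarrow> real \<Rightarrow> 'e" where
  "hermite a b s = (3 * s^2 - 2 * s^3) *\<^sub>R a + (s^3 - s^2) *\<^sub>R b"

definition hermite_deriv :: "'e::real_normed_vector \<Rightarrow> 'e \<Rightarrow> real \<Rightarrow> 'e" where
  "hermite_deriv a b s = (6 * s - 6 * s^2) *\<^sub>R a + (3 * s^2 - 2 * s) *\<^sub>R b"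

lemma has_C1_derivative_hermite: "has_C1_derivative (hermite a b) (hermite_deriv a b) S"
  unfolding has_C1_derivative_def
proof (intro conjI ballI)
  show "continuous_on S (hermite_deriv a b)"
    unfolding hermite_deriv_def by (intro continuous_intros)
  fix t assume "t \<in> S"
  show "(hermite a b has_vector_derivative hermite_deriv a b t) (at t within S)"
    unfolding hermite_def hermite_deriv_def
    by (auto intro!: derivative_eq_intros simp: field_simps)
qed

lemma hermite_bounds:
  assumes "s \<in> {0..1}" "norm a \<le> c" "norm b \<le> c"
  shows "norm (hermite a b s) \<le> 2 * c" "norm (hermite_deriv a b s) \<le> 3 * c"
proof -
  have s: "0 \<le> s" "s \<le> 1"
    using assms(1) by auto
  have c: "0 \<le> c"
    using norm_ge_zero[of a] assms(2) by (rule order_trans)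
  have lin: "norm (x *\<^sub>R a + y *\<^sub>R b) \<le> p * c + q * c" if "\<bar>x\<bar> \<le> p" "\<bar>y\<bar> \<le> q" for x y p q
    using that assms c by (intro norm_triangle_le add_mono) (auto intro!: mult_mono)
  have p: "0 \<le> s^2" "s^2 \<le> s" "0 \<le> s^3" "s^3 \<le> s^2"
    using s by (auto simp: power2_eq_square power3_eq_cube mult_left_le mult_left_le_one_le)
  \<comment> \<open>The squares bound \<open>6s - 6s\<^sup>2\<close> by \<open>3/2\<close> and \<open>3s\<^sup>2 - 2s\<close> from below by \<open>-1/3\<close>; the last product
    is \<open>1 - (3s\<^sup>2 - 2s\<^sup>3)\<close>.\<close>
  have sq: "0 \<le> (2 * s - 1)^2" "0 \<le> (3 * s - 1)^2" "0 \<le> (1 - s)^2 * (1 + 2 * s)"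
    using s by auto
  have "\<bar>3 * s^2 - 2 * s^3\<bar> \<le> 1" "\<bar>s^3 - s^2\<bar> \<le> 1" "\<bar>6 * s - 6 * s^2\<bar> \<le> 2" "\<bar>3 * s^2 - 2 * s\<bar> \<le> 1"
    using p sq s by (simp_all add: abs_le_iff power2_eq_square power3_eq_cube algebra_simps)
  then show "norm (hermite a b s) \<le> 2 * c" "norm (hermite_deriv a b s) \<le> 3 * c"
    using lin[of "3 * s^2 - 2 * s^3" 1 "s^3 - s^2" 1] lin[of "6 * s - 6 * s^2" 2 "3 * s^2 - 2 * s" 1]
    unfolding hermite_def hermite_deriv_def by auto
qed

text \<open>
  It is left unrestricted, so that one function yields prolongations both over \<open>[0,\<infinity>)\<close>, which
  closedness asks for, and over \<open>[0,1+r]\<close>, where regulatedness measures the norm.  For \<open>r = 0\<close>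
  the middle piece is a single point, and \<^const>\<open>deriv_on\<close> supplies the derivative \<open>0\<close> there.
\<close>

definition bridge :: "real \<Rightarrow> (real \<Rightarrow> 'e) \<Rightarrow> real \<Rightarrow> 'e::real_normed_vector" where
  "bridge r \<phi> s =
     (if s \<le> 0 then 0
      else if s \<le> 1 then hermite (\<phi> (- r)) (deriv_on {- r..0} \<phi> (- r)) s
      else if s \<le> 1 + r then \<phi> (s - (1 + r))
      else \<phi> 0 + (s - (1 + r)) *\<^sub>R deriv_on {- r..0} \<phi> 0)"

definition bridge_deriv :: "real \<Rightarrow> (real \<Rightarrow> 'e) \<Rightarrow> real \<Rightarrow> 'e::real_normed_vector" where
  "bridge_deriv r \<phi> s =
     (if s \<le> 1 then hermite_deriv (\<phi> (- r)) (deriv_on {- r..0} \<phi> (- r)) s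
      else if s \<le> 1 + r then deriv_on {- r..0} \<phi> (s - (1 + r))
      else deriv_on {- r..0} \<phi> 0)"

text \<open>
  The pieces are described on closed, overlapping intervals, as gluing requires; the case
  distinctions above decide the junctions one way only.
\<close>

lemma bridge_eqs:
  assumes "0 \<le> r"
  shows "s \<le> 0 \<Longrightarrow> bridge r \<phi> s = 0"
    and "s \<in> {0..1} \<Longrightarrow> bridge r \<phi> s = hermite (\<phi> (- r)) (deriv_on {- r..0} \<phi> (- r)) s"
    and "s \<in> {1..1 + r} \<Longrightarrow> bridge r \<phi> s = \<phi> (s - (1 + r))"
    and "1 + r \<le> s \<Longrightarrow> bridge r \<phi> s = \<phi> 0 + (s - (1 + r)) *\<^sub>R deriv_on {- r..0} \<phi> 0"
    and "s \<in> {0..1} \<Longrightarrow> bridge_deriv r \<phi> s = hermite_deriv (\<phi> (- r)) (deriv_on {- r..0} \<phi> (- r)) s"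
    and "s \<in> {1..1 + r} \<Longrightarrow> bridge_deriv r \<phi> s = deriv_on {- r..0} \<phi> (s - (1 + r))"
    and "1 + r \<le> s \<Longrightarrow> bridge_deriv r \<phi> s = deriv_on {- r..0} \<phi> 0"
proof -
  show "s \<le> 0 \<Longrightarrow> bridge r \<phi> s = 0" by (simp add: bridge_def)
  show "s \<in> {0..1} \<Longrightarrow> bridge r \<phi> s = hermite (\<phi> (- r)) (deriv_on {- r..0} \<phi> (- r)) s"
    by (cases "s = 0") (auto simp: bridge_def hermite_def)
  show "s \<in> {1..1 + r} \<Longrightarrow> bridge r \<phi> s = \<phi> (s - (1 + r))"
    by (cases "s = 1") (auto simp: bridge_def hermite_def)
  show "1 + r \<le> s \<Longrightarrow> bridge r \<phi> s = \<phi> 0 + (s - (1 + r)) *\<^sub>R deriv_on {- r..0} \<phi> 0"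
    using assms by (cases "s = 1 + r"; cases "r = 0") (auto simp: bridge_def hermite_def)
  show "s \<in> {0..1} \<Longrightarrow> bridge_deriv r \<phi> s = hermite_deriv (\<phi> (- r)) (deriv_on {- r..0} \<phi> (- r)) s"
    by (auto simp: bridge_deriv_def)
  show "s \<in> {1..1 + r} \<Longrightarrow> bridge_deriv r \<phi> s = deriv_on {- r..0} \<phi> (s - (1 + r))"
    by (cases "s = 1") (auto simp: bridge_deriv_def hermite_deriv_def)
  show "1 + r \<le> s \<Longrightarrow> bridge_deriv r \<phi> s = deriv_on {- r..0} \<phi> 0"
    using assms by (cases "s = 1 + r"; cases "r = 0") (auto simp: bridge_deriv_def hermite_deriv_def)
qed

text \<open>
  The three pieces and their derivatives agree at the junctions \<open>1\<close> and \<open>1 + r\<close>: there the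
  interpolant was built to match \<open>\<phi>\<close>, and the affine piece is the tangent of \<open>\<phi>\<close> at \<open>0\<close>.
\<close>

lemma bridge_has_C1_derivative:
  assumes r: "0 \<le> r" and \<phi>: "C1_on {- r..0} \<phi>"
  shows "has_C1_derivative (bridge r \<phi>) (bridge_deriv r \<phi>) {0..}"
proof -
  let ?d = "deriv_on {- r..0} \<phi>"
  have 1: "has_C1_derivative (bridge r \<phi>) (bridge_deriv r \<phi>) {0..1}"
    by (rule has_C1_derivative_cong[OF has_C1_derivative_hermite]) (simp_all add: bridge_eqs[OF r])
  have "{t. - (1 + r) + t \<in> {- r..0}} = {1..1 + r}"
    by auto
  then have "has_C1_derivative (\<lambda>t. \<phi> (- (1 + r) + t)) (\<lambda>t. ?d (- (1 + r) + t)) {1..1 + r}"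
    using has_C1_derivative_shift[OF has_C1_derivative_deriv_on[OF is_interval_cc \<phi>], of "- (1 + r)"]
    by simp
  then have 2: "has_C1_derivative (bridge r \<phi>) (bridge_deriv r \<phi>) {1..1 + r}"
    by (rule has_C1_derivative_cong) (simp_all add: bridge_eqs[OF r] algebra_simps)
  have "has_C1_derivative (\<lambda>s. \<phi> 0 + (s - (1 + r)) *\<^sub>R ?d 0) (\<lambda>s. ?d 0) {1 + r..}"
    unfolding has_C1_derivative_def by (auto intro!: derivative_eq_intros)
  then have 3: "has_C1_derivative (bridge r \<phi>) (bridge_deriv r \<phi>) {1 + r..}"
    by (rule has_C1_derivative_cong) (simp_all add: bridge_eqs[OF r])
  have pieces: "{0..} = {0..1} \<union> ({1..1 + r} \<union> {1 + r..})"
    using r by auto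
  show ?thesis
    unfolding pieces by (intro has_C1_derivative_Un closed_Un 1 2 3) simp_all
qed

lemma bridge_prolongation:
  assumes "0 \<le> r" "C1_on {- r..0} \<phi>" "is_interval J" "0 \<in> J" "J \<noteq> {0}" "J \<subseteq> {0..}"
  shows "C1_prolongation_of_zero_0deriv {- r..0} J (\<lambda>s\<in>interval_sum J {- r..0}. bridge r \<phi> s)"
proof (rule restrict_is_prolongation_of_zero[OF assms(3,4,5,6)])
  show "has_C1_derivative (bridge r \<phi>) (bridge_deriv r \<phi>) J"
    using assms(6) by (rule has_C1_derivative_subset[OF bridge_has_C1_derivative[OF assms(1,2)]])
  show "bridge_deriv r \<phi> 0 = 0"
    by (simp add: bridge_deriv_def hermite_deriv_def)
  show "0 \<in> {- r..0}" and "\<And>\<theta>. \<theta> \<in> {- r..0} \<Longrightarrow> bridge r \<phi> \<theta> = 0"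
    using assms(1) by (simp_all add: bridge_eqs(1))
qed

lemma segment_at_bridge:
  assumes "0 \<le> r" "\<phi> \<in> C1_maps {- r..0}" "1 + r \<in> J"
  shows "segment_at {- r..0} (1 + r) (\<lambda>s\<in>interval_sum J {- r..0}. bridge r \<phi> s) = \<phi>"
proof -
  have "(\<lambda>\<theta>\<in>{- r..0}. bridge r \<phi> (1 + r + \<theta>)) = (\<lambda>\<theta>\<in>{- r..0}. \<phi> \<theta>)"
    using assms(1) by (intro restrict_ext) (simp add: bridge_eqs(3))
  also have "\<dots> = \<phi>"
    using assms(2) by (auto simp: C1_maps_def PiE_def extensional_restrict)
  finally show ?thesis
    using assms(3) by (simp add: segment_at_restrict)
qed

text \<open>
  The constant is \<open>2 + 3\<close>, from the bounds for the interpolant and for its derivative; on the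
  piece that repeats \<open>\<phi>\<close> the factor \<open>1\<close> would do.
\<close>

lemma C1_norm_bridge_le:
  assumes r: "0 \<le> r" and \<phi>: "C1_on {- r..0} \<phi>"
  shows "C1_norm {0..1 + r} (\<lambda>s\<in>interval_sum {0..1 + r} {- r..0}. bridge r \<phi> s)
    \<le> 5 * C1_norm {- r..0} \<phi>"
proof -
  let ?c = "C1_norm {- r..0} \<phi>"
  have up: "norm (\<phi> t) \<le> ?c" "norm (deriv_on {- r..0} \<phi> t) \<le> ?c" if "t \<in> {- r..0}" for t
    using C1_norm_upper[OF _ \<phi> that] r by auto
  have c: "0 \<le> ?c"
    using order_trans[OF norm_ge_zero up(1)[of 0]] r by simp
  have bd: "norm (bridge r \<phi> s) \<le> 2 * ?c \<and> norm (bridge_deriv r \<phi> s) \<le> 3 * ?c"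
    if s: "s \<in> {0..1 + r}" for s
  proof (cases "s \<le> 1")
    case True
    then show ?thesis
      using s r hermite_bounds[of s, OF _ up[of "- r"]] by (simp add: bridge_eqs(2,5))
  next
    case False
    then show ?thesis
      using s r c up[of "s - (1 + r)"] by (simp add: bridge_eqs(3,6))
  qed
  have J: "{0..1 + r} \<subseteq> interval_sum {0..1 + r} {- r..0}"
    using r by (intro interval_sum_supersets(1)) simp
  have same: "(\<lambda>s\<in>interval_sum {0..1 + r} {- r..0}. bridge r \<phi> s) s = bridge r \<phi> s"
    if "s \<in> {0..1 + r}" for s
    using J that by (simp add: subset_iff)
  have "has_C1_derivative (bridge r \<phi>) (bridge_deriv r \<phi>) {0..1 + r}"
    by (rule has_C1_derivative_subset[OF bridge_has_C1_derivative[OF r \<phi>]]) simp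
  then have "has_C1_derivative (\<lambda>s\<in>interval_sum {0..1 + r} {- r..0}. bridge r \<phi> s)
    (bridge_deriv r \<phi>) {0..1 + r}"
    by (rule has_C1_derivative_cong) (simp_all only: same)
  then have "C1_norm {0..1 + r} (\<lambda>s\<in>interval_sum {0..1 + r} {- r..0}. bridge r \<phi> s)
    \<le> 2 * ?c + 3 * ?c"
  proof (rule C1_norm_le[rotated])
    fix s assume s: "s \<in> {0..1 + r}"
    show "norm ((\<lambda>s\<in>interval_sum {0..1 + r} {- r..0}. bridge r \<phi> s) s) \<le> 2 * ?c"
      using bd[OF s] unfolding same[OF s] by blast
    show "norm (bridge_deriv r \<phi> s) \<le> 3 * ?c"
      using bd[OF s] by blast
  qed (use r in simp)
  then show ?thesis by simp
qed

lemma C1_maps_subset_if_zero_closed: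
  fixes H :: "(real \<Rightarrow> 'e::real_normed_vector) topology"
  assumes "0 \<le> r" "zero_closed_under_C1_prolongations {- r..0} H"
  shows "C1_maps {- r..0} \<subseteq> topspace H"
proof
  fix \<phi> :: "real \<Rightarrow> 'e" assume \<phi>: "\<phi> \<in> C1_maps {- r..0}"
  have "(1::real) \<in> {0..}" "(1::real) \<notin> {0}"
    by simp_all
  then have "{0::real..} \<noteq> {0}"
    by blast
  then have "C1_prolongation_of_zero_0deriv {- r..0} {0..}
    (\<lambda>s\<in>interval_sum {0..} {- r..0}. bridge r \<phi> s)"
    using \<phi> assms(1) by (intro bridge_prolongation) (auto simp: C1_maps_def is_interval_ci)
  then have "\<forall>t\<ge>0. segment_at {- r..0} t (\<lambda>s\<in>interval_sum {0..} {- r..0}. bridge r \<phi> s) \<in> topspace H"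
    using assms(2) unfolding zero_closed_under_C1_prolongations_def by blast
  then have "segment_at {- r..0} (1 + r) (\<lambda>s\<in>interval_sum {0..} {- r..0}. bridge r \<phi> s) \<in> topspace H"
    using assms(1) by simp
  then show "\<phi> \<in> topspace H"
    using segment_at_bridge[OF assms(1) \<phi>, of "{0..}"] assms(1) by simp
qed

section \<open>Segments of prolongations\<close>

text \<open>
  On \<open>[-r,0]\<close> the prolongation is constant with derivative \<open>0\<close>, which is also its right
  derivative at \<open>0\<close>.  So both pieces glue, and a segment sees only values that occur on
  \<open>[0,\<tau>]\<close>, or \<open>0\<close>.
\<close>

lemma segment_of_prolongation:
  assumes r: "0 \<le> r" and \<tau>: "0 < \<tau>"
    and \<gamma>: "C1_prolongation_of_zero_0deriv {- r..0} {0..\<tau>} \<gamma>"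
  shows "segment_at {- r..0} \<tau> \<gamma> \<in> C1_maps {- r..0}"
    and "C1_norm {- r..0} (segment_at {- r..0} \<tau> \<gamma>) \<le> C1_norm {0..\<tau>} \<gamma>"
proof -
  let ?d = "deriv_on {0..\<tau>} \<gamma>"
  define d where "d t = (if t \<le> 0 then 0 else ?d t)" for t
  have \<gamma>0: "\<And>t. t \<in> {- r..0} \<Longrightarrow> \<gamma> t = 0"
    and C1: "C1_on {0..\<tau>} \<gamma>" and d0: "?d 0 = 0"
    using \<gamma> by (auto simp: C1_prolongation_of_zero_0deriv_def C1_prolongation_of_zero_def)
  have "has_C1_derivative (\<lambda>t. 0) (\<lambda>t. 0) {- r..0}"
    by (auto simp: has_C1_derivative_def)
  then have past: "has_C1_derivative \<gamma> d {- r..0}"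
    by (rule has_C1_derivative_cong) (auto simp: d_def \<gamma>0)
  have future: "has_C1_derivative \<gamma> d {0..\<tau>}"
    by (rule has_C1_derivative_cong[OF has_C1_derivative_deriv_on[OF is_interval_cc C1]])
      (auto simp: d_def d0)
  have "has_C1_derivative \<gamma> d ({- r..0} \<union> {0..\<tau>})"
    by (intro has_C1_derivative_Un past future) auto
  then have "has_C1_derivative (\<lambda>\<theta>. \<gamma> (\<tau> + \<theta>)) (\<lambda>\<theta>. d (\<tau> + \<theta>)) {- r..0}"
    using \<tau> by (rule_tac has_C1_derivative_subset[OF has_C1_derivative_shift]) auto
  then have seg: "has_C1_derivative (segment_at {- r..0} \<tau> \<gamma>) (\<lambda>\<theta>. d (\<tau> + \<theta>)) {- r..0}"
    by (rule has_C1_derivative_cong) (auto simp: segment_at_def)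
  then show "segment_at {- r..0} \<tau> \<gamma> \<in> C1_maps {- r..0}"
    by (auto simp: C1_maps_def C1_on_iff_has_C1_derivative segment_at_def)
  let ?A = "SUP t\<in>{0..\<tau>}. norm (\<gamma> t)" and ?B = "SUP t\<in>{0..\<tau>}. norm (?d t)"
  have A: "norm (\<gamma> t) \<le> ?A" and B: "norm (?d t) \<le> ?B" if "t \<in> {0..\<tau>}" for t
    using C1_bdd[OF _ C1] that \<tau> by (auto intro!: cSUP_upper)
  have AB: "0 \<le> ?A" "0 \<le> ?B"
    using order_trans[OF norm_ge_zero A[of 0]] order_trans[OF norm_ge_zero B[of 0]] \<tau> by simp_all
  have "norm (segment_at {- r..0} \<tau> \<gamma> \<theta>) \<le> ?A" "norm (d (\<tau> + \<theta>)) \<le> ?B"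
    if \<theta>: "\<theta> \<in> {- r..0}" for \<theta>
  proof -
    show "norm (segment_at {- r..0} \<tau> \<gamma> \<theta>) \<le> ?A"
      using \<theta> \<tau> A[of "\<tau> + \<theta>"] \<gamma>0[of "\<tau> + \<theta>"] AB
      by (cases "\<tau> + \<theta> \<le> 0") (auto simp: segment_at_def)
    show "norm (d (\<tau> + \<theta>)) \<le> ?B"
      using \<theta> B[of "\<tau> + \<theta>"] AB by (auto simp: d_def)
  qed
  then show "C1_norm {- r..0} (segment_at {- r..0} \<tau> \<gamma>) \<le> C1_norm {0..\<tau>} \<gamma>"
    using C1_norm_le[OF _ seg, of ?A ?B] r by (simp add: C1_norm_def[of "{0..\<tau>}"])
qed

section \<open>Continuity of the inclusion\<close>

lemma continuous_map_add_map_left: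
  assumes "history_space I H" "f \<in> topspace H"
  shows "continuous_map H H (add_map I f)"
proof -
  have "continuous_map H (prod_topology H H) (\<lambda>g. (f, g))"
    using assms(2) by (simp add: continuous_map_pairwise o_def)
  moreover have "continuous_map (prod_topology H H) H (\<lambda>(f, g). add_map I f g)"
    using assms(1) by (simp add: history_space_def)
  ultimately show ?thesis
    using continuous_map_compose by (fastforce simp: o_def)
qed

text \<open>
  The \<open>C\<^sup>1\<close> distance is translation invariant and the translations of \<open>H\<close> are continuous, so
  an open set around \<open>f\<close> pulls back to one around \<open>0\<close>.
\<close>

lemma continuous_inclusion_if_at_zero:
  fixes H :: "(real \<Rightarrow> 'e::real_normed_vector) topology"
  assumes ab: "a \<le> b" and H: "history_space {a..b} H" and sub: "C1_maps {a..b} \<subseteq> topspace H"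
    and at_zero: "\<And>U. openin H U \<Longrightarrow> zero_map {a..b} \<in> U \<Longrightarrow>
      \<exists>\<epsilon>>0. \<forall>h\<in>C1_maps {a..b}. C1_norm {a..b} h < \<epsilon> \<longrightarrow> h \<in> U"
  shows "continuous_map (C1_topology {a..b}) H (\<lambda>f. f)"
proof -
  let ?I = "{a..b}"
  interpret Metric_space "C1_maps ?I" "C1_dist ?I :: (real \<Rightarrow> 'e) \<Rightarrow> _"
    by (rule Metric_space_C1_dist[OF ab])
  have ball: "\<exists>\<epsilon>>0. mball f \<epsilon> \<subseteq> U" if U: "openin H U" and f: "f \<in> C1_maps ?I" "f \<in> U" for U f
  proof -
    define V where "V = {h \<in> topspace H. add_map ?I f h \<in> U}"
    have "openin H V"
      unfolding V_def using continuous_map_add_map_left[OF H] f(1) sub U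
      by (auto intro: openin_continuous_map_preimage)
    moreover have "add_map ?I f (zero_map ?I) = f"
      using f(1) by (auto simp: add_map_def zero_map_def C1_maps_def PiE_def extensional_def)
    then have "zero_map ?I \<in> V"
      using f H by (simp add: V_def history_space_def)
    ultimately have "\<exists>\<epsilon>>0. \<forall>h\<in>C1_maps ?I. C1_norm ?I h < \<epsilon> \<longrightarrow> h \<in> V"
      by (rule at_zero)
    then obtain \<epsilon> where \<epsilon>: "\<epsilon> > 0"
      "\<And>h. h \<in> C1_maps ?I \<Longrightarrow> C1_norm ?I h < \<epsilon> \<Longrightarrow> h \<in> V"
      by blast
    have "g \<in> U" if g: "g \<in> mball f \<epsilon>" for g
    proof -
      let ?h = "\<lambda>\<theta>\<in>?I. g \<theta> - f \<theta>"
      have gC: "g \<in> C1_maps ?I" "C1_norm ?I ?h < \<epsilon>"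
        using g commute[of f g] by (auto simp: C1_dist_def)
      have "?h \<in> C1_maps ?I"
        using C1_diff(1)[OF ab, of g f] gC(1) f(1) by (auto simp: C1_maps_def)
      then have "add_map ?I f ?h \<in> U"
        using \<epsilon>(2) gC(2) by (auto simp: V_def)
      moreover have "add_map ?I f ?h = g"
        using gC(1) by (auto simp: add_map_def C1_maps_def PiE_def extensional_def)
      ultimately show ?thesis by simp
    qed
    then show ?thesis using \<epsilon>(1) by blast
  qed
  have "openin mtopology {f \<in> C1_maps ?I. f \<in> U}" if U: "openin H U" for U
    unfolding openin_mtopology
  proof (intro conjI allI impI)
    fix f assume "f \<in> {f \<in> C1_maps ?I. f \<in> U}"
    then obtain \<epsilon> where "\<epsilon> > 0" "mball f \<epsilon> \<subseteq> U"
      using ball[OF U] by blast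
    then show "\<exists>\<epsilon>>0. mball f \<epsilon> \<subseteq> {f \<in> C1_maps ?I. f \<in> U}"
      using mball_subset_mspace by (intro exI[of _ \<epsilon>]) blast
  qed blast
  then show ?thesis
    using sub by (auto simp: continuous_map_def C1_topology_def)
qed

text \<open>
  Regulatedness at time \<open>1 + r\<close>, applied to the prolongations that end in small histories, gives
  continuity at \<open>0\<close>.
\<close>

lemma continuous_inclusion_if_regulated:
  assumes r: "0 \<le> r" and H: "history_space {- r..0} H"
    and sub: "C1_maps {- r..0} \<subseteq> topspace H"
    and reg: "regulated_by_C1_prolongations {- r..0} H"
  shows "continuous_map (C1_topology {- r..0}) H (\<lambda>\<phi>. \<phi>)"
proof (rule continuous_inclusion_if_at_zero[OF _ H sub])
  show "- r \<le> 0" using r by simp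
  fix U assume U: "openin H U" "zero_map {- r..0} \<in> U"
  have "U \<subseteq> topspace H" "0 < 1 + r"
    using U openin_subset r by auto
  then obtain \<delta> where \<delta>: "\<delta> > 0" "Lambda1 {- r..0} (1 + r) \<delta> \<subseteq> {0..1 + r} \<times> U"
    using reg U unfolding regulated_by_C1_prolongations_def by blast
  \<comment> \<open>The bound may be infinite, in which case any finite one serves.\<close>
  obtain e where e: "0 < e" "ennreal e \<le> \<delta>"
  proof (cases \<delta>)
    case (real x)
    then show thesis using \<delta>(1) that[of x] by auto
  next
    case top
    then show thesis using that[of 1] by simp
  qed
  have "\<phi> \<in> U" if \<phi>: "\<phi> \<in> C1_maps {- r..0}" and small: "C1_norm {- r..0} \<phi> < e / 5" for \<phi>
  proof -
    let ?\<gamma> = "\<lambda>s\<in>interval_sum {0..1 + r} {- r..0}. bridge r \<phi> s"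
    have C1: "C1_on {- r..0} \<phi>" using \<phi> by (simp add: C1_maps_def)
    have "1 + r \<in> {0..1 + r}" "1 + r \<notin> {0}"
      using r by simp_all
    then have "{0..1 + r} \<noteq> {0}"
      by blast
    then have "C1_prolongation_of_zero_0deriv {- r..0} {0..1 + r} ?\<gamma>"
      using r C1 by (intro bridge_prolongation) (auto simp: is_interval_cc)
    moreover have "ennreal (C1_norm {0..1 + r} ?\<gamma>) \<le> \<delta>"
      using C1_norm_bridge_le[OF r C1] small e(2)
      by (intro order_trans[OF ennreal_leI e(2)]) simp
    ultimately have "?\<gamma> \<in> Gamma1 {- r..0} (1 + r) \<delta>"
      using r by (simp add: Gamma1_def)
    then have "(1 + r, segment_at {- r..0} (1 + r) ?\<gamma>) \<in> Lambda1 {- r..0} (1 + r) \<delta>"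
      using r unfolding Lambda1_def by (intro UN_I[of "1 + r"]) auto
    then show ?thesis
      using \<delta>(2) segment_at_bridge[OF r \<phi>, of "{0..1 + r}"] r by auto
  qed
  then show "\<exists>\<epsilon>>0. \<forall>h\<in>C1_maps {- r..0}. C1_norm {- r..0} h < \<epsilon> \<longrightarrow> h \<in> U"
    using e(1) by (intro exI[of _ "e / 5"]) auto
qed

lemma regulated_if_continuous_inclusion:
  fixes H :: "(real \<Rightarrow> 'e::real_normed_vector) topology"
  assumes r: "0 \<le> r" and cont: "continuous_map (C1_topology {- r..0}) H (\<lambda>\<phi>. \<phi>)"
  shows "regulated_by_C1_prolongations {- r..0} H"
  unfolding regulated_by_C1_prolongations_def
proof (intro allI impI)
  fix T :: real and N
  assume "\<exists>U. openin H U \<and> zero_map {- r..0} \<in> U \<and> U \<subseteq> N"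
  then obtain U where U: "openin H U" "zero_map {- r..0} \<in> U" "U \<subseteq> N"
    by blast
  interpret Metric_space "C1_maps {- r..0}" "C1_dist {- r..0} :: (real \<Rightarrow> 'e) \<Rightarrow> _"
    using r by (intro Metric_space_C1_dist) simp
  have "openin mtopology {\<phi> \<in> topspace mtopology. \<phi> \<in> U}"
    using openin_continuous_map_preimage[OF cont U(1)] unfolding C1_topology_def .
  then have "openin mtopology {\<phi> \<in> C1_maps {- r..0}. \<phi> \<in> U}"
    by (simp only: topspace_mtopology)
  moreover have "zero_map {- r..0} \<in> {\<phi> \<in> C1_maps {- r..0}. \<phi> \<in> U}"
    using U(2) zero_map_in_C1_maps by blast
  ultimately have "\<exists>\<epsilon>>0. mball (zero_map {- r..0}) \<epsilon> \<subseteq> {\<phi> \<in> C1_maps {- r..0}. \<phi> \<in> U}"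
    unfolding openin_mtopology by (elim conjE allE impE)
  then obtain \<epsilon> where \<epsilon>: "\<epsilon> > 0" "mball (zero_map {- r..0}) \<epsilon> \<subseteq> U"
    by blast
  have "segment_at {- r..0} \<tau> \<gamma> \<in> N" if \<tau>: "\<tau> \<in> {0..T}"
    and \<gamma>: "\<gamma> \<in> Gamma1 {- r..0} \<tau> (ennreal (\<epsilon> / 2))" for \<tau> \<gamma>
  proof (cases "\<tau> = 0")
    case True
    then have "segment_at {- r..0} \<tau> \<gamma> = zero_map {- r..0}"
      using \<gamma> by (auto simp: Gamma1_def segment_at_def zero_map_def)
    then show ?thesis using U by auto
  next
    case False
    then have *: "0 < \<tau>" "C1_prolongation_of_zero_0deriv {- r..0} {0..\<tau>} \<gamma>"
      "C1_norm {0..\<tau>} \<gamma> \<le> \<epsilon> / 2"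
      using \<tau> \<gamma> \<epsilon>(1) by (auto simp: Gamma1_def ennreal_le_iff)
    then have "C1_norm {- r..0} (segment_at {- r..0} \<tau> \<gamma>) < \<epsilon>"
      using segment_of_prolongation(2)[OF r *(1,2)] \<epsilon>(1) by linarith
    moreover have seg: "segment_at {- r..0} \<tau> \<gamma> \<in> C1_maps {- r..0}"
      by (rule segment_of_prolongation(1)[OF r *(1,2)])
    moreover have "C1_dist {- r..0} (zero_map {- r..0}) (segment_at {- r..0} \<tau> \<gamma>)
      = C1_norm {- r..0} (segment_at {- r..0} \<tau> \<gamma>)"
      by (subst commute) (rule C1_dist_zero_map[OF seg])
    ultimately have "segment_at {- r..0} \<tau> \<gamma> \<in> mball (zero_map {- r..0}) \<epsilon>"
      by (simp only: in_mball zero_map_in_C1_maps simp_thms)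
    then show ?thesis using \<epsilon>(2) U(3) by blast
  qed
  then have "Lambda1 {- r..0} T (ennreal (\<epsilon> / 2)) \<subseteq> {0..T} \<times> N"
    by (auto simp: Lambda1_def)
  then show "\<exists>\<delta>>0. Lambda1 {- r..0} T \<delta> \<subseteq> {0..T} \<times> N"
    using \<epsilon>(1) by (intro exI[of _ "ennreal (\<epsilon> / 2)"]) simp
qed

theorem theorem3p12:
  fixes r :: real
    and H :: "(real \<Rightarrow> 'e::banach) topology"
  assumes "0 \<le> r"
    and "history_space (hist_interval r) H"
    and "zero_closed_under_C1_prolongations (hist_interval r) H"
  shows "C1_maps (hist_interval r) \<subseteq> topspace H \<and>
    (regulated_by_C1_prolongations (hist_interval r) H \<longleftrightarrow>
     continuous_map (C1_topology (hist_interval r)) H (\<lambda>\<phi>. \<phi>))"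
  using C1_maps_subset_if_zero_closed[OF assms(1,3)]
    continuous_inclusion_if_regulated[OF assms(1,2)] regulated_if_continuous_inclusion[OF assms(1)]
  by blast

end
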